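(* For every ordered graph $F$, $$\rho_{<}(F)\ge\lambda(F).$$
   Context: An ordered graph is a finite graph with a fixed linear order on its vertices. An ordered copy of $F$ in $H$ is an injective graph embedding (edges map to edges, not necessarily induced) of $F$ into $H$ that preserves the vertex order. For ordered graphs $F,G$ let $\operatorname{ex}_{<}(G,F)=\max\{e(H): H\subseteq G,\ H \text{ contains no ordered copy of } F\}$. The relative Turán density of $F$ is $\rho_{<}(F)=\inf_G \operatorname{ex}_{<}(G,F)/e(G)$, where the infimum is over all ordered graphs $G$ with at least one edge. A weighted forward-edge template is a triple $\mathcal T=(Q,\mu,A)$, where $Q$ is a finite label set, $\mu$ is a probability measure on $Q$, and $A\subseteq Q\times Q$. The template supports an ordered graph $F$ if there is a map (not necessarily injective) $\phi:V(F)\to Q$ such that $(\phi(i),\phi(j))\in A$ for every edge $ij$ of $F$ with $i<j$; otherwise it is $F$-avoiding. Put $w(\mathcal T)=\sum_{(q,q')\in A}\mu(q)\mu(q')$ and $\lambda(F)=\sup\{w(\mathcal T):\mathcal T\text{ is }F\text{-avoiding}\}$. Convention for the degenerate case where $F$ has no edges: a maximum or supremum over the empty set is $0$. *)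

theory Defs
  imports "HOL-Probability.Probability"
begin

(* The linear order on the vertices is the one inherited from the type 'v. *)
record 'v ograph =
  verts :: "'v set"
  edges :: "'v set set"

definition ordered_graph :: "'v::linorder ograph \<Rightarrow> bool" where
  "ordered_graph G \<longleftrightarrow>
     finite (verts G) \<and> (\<forall>e\<in>edges G. e \<subseteq> verts G \<and> card e = 2)"

definition subgraph_of :: "'v::linorder ograph \<Rightarrow> 'v ograph \<Rightarrow> bool" where
  "subgraph_of H G \<longleftrightarrow> ordered_graph H \<and> verts H \<subseteq> verts G \<and> edges H \<subseteq> edges G"

definition ordered_copy ::
    "('v \<Rightarrow> 'w) \<Rightarrow> 'v::linorder ograph \<Rightarrow> 'w::linorder ograph \<Rightarrow> bool" where
  "ordered_copy f F H \<longleftrightarrow>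
     f ` verts F \<subseteq> verts H \<and> strict_mono_on (verts F) f \<and> (\<forall>e\<in>edges F. f ` e \<in> edges H)"

definition contains_copy :: "'w::linorder ograph \<Rightarrow> 'v::linorder ograph \<Rightarrow> bool" where
  "contains_copy H F \<longleftrightarrow> (\<exists>f. ordered_copy f F H)"

(* The maximum and the supremum below are 0 over the empty set by convention;
   HOL leaves Max {} and the supremum of the empty set of reals unspecified. *)
definition ex_ord :: "'w::linorder ograph \<Rightarrow> 'v::linorder ograph \<Rightarrow> nat" where
  "ex_ord G F =
     (let S = {card (edges H) | H. subgraph_of H G \<and> \<not> contains_copy H F}
      in if S = {} then 0 else Max S)"

(* Every finite linear order embeds in nat, so the ordered graphs on natural numbers
   represent all isomorphism types of ordered graphs G. *)
definition rel_turan_density :: "'v::linorder ograph \<Rightarrow> real" where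
  "rel_turan_density F =
     Inf {real (ex_ord G F) / real (card (edges G)) | G :: nat ograph.
            ordered_graph G \<and> edges G \<noteq> {}}"

record 'q template =
  labels :: "'q set"
  weight :: "'q pmf"
  arcs :: "('q \<times> 'q) set"

definition fwd_template :: "'q template \<Rightarrow> bool" where
  "fwd_template T \<longleftrightarrow>
     finite (labels T) \<and> set_pmf (weight T) \<subseteq> labels T \<and> arcs T \<subseteq> labels T \<times> labels T"

definition supports :: "'q template \<Rightarrow> 'v::linorder ograph \<Rightarrow> bool" where
  "supports T F \<longleftrightarrow>
     (\<exists>\<phi>. \<phi> ` verts F \<subseteq> labels T \<and>
        (\<forall>i j. i < j \<and> {i, j} \<in> edges F \<longrightarrow> (\<phi> i, \<phi> j) \<in> arcs T))"

definition template_weight :: "'q template \<Rightarrow> real" where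
  "template_weight T = (\<Sum>(q, q')\<in>arcs T. pmf (weight T) q * pmf (weight T) q')"

(* Label sets are finite and carry no structure, so natural numbers suffice as labels. *)
definition template_density :: "'v::linorder ograph \<Rightarrow> real" where
  "template_density F =
     (let S = {template_weight T | T :: nat template. fwd_template T \<and> \<not> supports T F}
      in if S = {} then 0 else Sup S)"

end

theory Submission
  imports Defs
begin

text \<open>
  The lower bound is a first-moment argument. Let \<open>T\<close> be a template that does not support \<open>F\<close> and
  let \<open>G\<close> be an ordered graph. Colour the vertices of \<open>G\<close> independently with labels drawn from the
  weight of \<open>T\<close>, and keep an edge when its lower and upper endpoint carry labels that form an arc
  of \<open>T\<close>. The two endpoints are distinct and hence independent, so every edge survives with
  probability exactly \<open>template_weight T\<close> (\<open>prob_coloured_pair_in_arcs\<close>), and some colouring keeps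
  at least that fraction of all edges (\<open>exists_colouring_many_arc_edges\<close>).

  Whatever the colouring, the surviving graph has no ordered copy of \<open>F\<close>: reading off the colours
  along a copy would be a map by which \<open>T\<close> supports \<open>F\<close> (\<open>not_contains_copy_arc_subgraph\<close>). Order
  preservation is what makes the orientation of the arcs agree with that of the edges.
  Thus \<open>ex_ord G F\<close> is at least \<open>template_weight T\<close> times the number of edges of \<open>G\<close>, for all \<open>T\<close>
  and \<open>G\<close>, and the inequality between the supremum and the infimum follows.
\<close>

definition arc_subgraph :: "('w \<Rightarrow> 'q) \<Rightarrow> 'q template \<Rightarrow> 'w::linorder ograph \<Rightarrow> 'w ograph" where
  "arc_subgraph c T G =
     \<lparr>verts = verts G, edges = {e \<in> edges G. (c (Min e), c (Max e)) \<in> arcs T}\<rparr>"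

lemma subgraph_of_arc_subgraph:
  assumes "ordered_graph G"
  shows "subgraph_of (arc_subgraph c T G) G"
  using assms unfolding subgraph_of_def ordered_graph_def arc_subgraph_def by auto

lemma finite_edges:
  assumes "ordered_graph G"
  shows "finite (edges G)"
  by (rule finite_subset[of _ "Pow (verts G)"]) (use assms in \<open>auto simp: ordered_graph_def\<close>)

text \<open>
  Composing a copy with the colouring turns it into a homomorphism to the template.
\<close>
lemma not_contains_copy_arc_subgraph:
  assumes F: "ordered_graph F" and T: "\<not> supports T F" and c: "c ` verts G \<subseteq> labels T"
  shows "\<not> contains_copy (arc_subgraph c T G) F"
proof
  assume "contains_copy (arc_subgraph c T G) F"
  then obtain f where f: "ordered_copy f F (arc_subgraph c T G)"
    unfolding contains_copy_def by blast
  have "(c (f i), c (f j)) \<in> arcs T" if "i < j" "{i, j} \<in> edges F" for i j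
  proof -
    have "i \<in> verts F" "j \<in> verts F"
      using F that unfolding ordered_graph_def by auto
    hence "f i < f j"
      using f that unfolding ordered_copy_def by (auto dest: strict_mono_onD)
    moreover have "f ` {i, j} \<in> edges (arc_subgraph c T G)"
      using f that unfolding ordered_copy_def by blast
    ultimately show ?thesis
      unfolding arc_subgraph_def by (auto simp: min_def max_def split: if_splits)
  qed
  moreover have "(c \<circ> f) ` verts F \<subseteq> labels T"
    using f c unfolding ordered_copy_def arc_subgraph_def by auto
  ultimately have "supports T F"
    unfolding supports_def by (intro exI[of _ "c \<circ> f"]) auto
  with T show False by contradiction
qed

lemma prob_coloured_pair_in_arcs:
  assumes V: "finite V" "x \<in> V" "y \<in> V" "x \<noteq> y" and A: "finite (arcs T)"
  shows "measure_pmf.prob (Pi_pmf V d (\<lambda>_. weight T)) {c. (c x, c y) \<in> arcs T} = template_weight T"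
proof -
  let ?M = "Pi_pmf V d (\<lambda>_. weight T)"
  have pair: "measure_pmf.prob ?M {c. c x = q \<and> c y = q'} = pmf (weight T) q * pmf (weight T) q'"
    for q q'
  proof -
    let ?B = "\<lambda>z. if z = x then {q} else if z = y then {q'} else UNIV"
    have "{c. c x = q \<and> c y = q'} = Pi V ?B"
      using V by (auto simp: Pi_def)
    hence "measure_pmf.prob ?M {c. c x = q \<and> c y = q'} = (\<Prod>z\<in>V. measure_pmf.prob (weight T) (?B z))"
      using V(1) by (simp only: measure_Pi_pmf_Pi)
    also have "\<dots> = (\<Prod>z\<in>{x, y}. measure_pmf.prob (weight T) (?B z))"
      using V by (intro prod.mono_neutral_right) auto
    finally show ?thesis
      using V(4) by (simp add: measure_pmf_single)
  qed
  have "{c. (c x, c y) \<in> arcs T} = (\<Union>(q, q')\<in>arcs T. {c. c x = q \<and> c y = q'})"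
    by auto
  also have "measure_pmf.prob ?M \<dots>
      = (\<Sum>p\<in>arcs T. measure_pmf.prob ?M (case p of (q, q') \<Rightarrow> {c. c x = q \<and> c y = q'}))"
    using A by (intro measure_pmf.finite_measure_finite_Union) (auto simp: disjoint_family_on_def)
  also have "\<dots> = template_weight T"
    unfolding template_weight_def by (intro sum.cong) (auto simp: pair split: prod.split)
  finally show ?thesis .
qed

text \<open>
  The expected number of surviving edges is \<open>template_weight T * card (edges G)\<close> by linearity, and
  a random variable cannot stay below its mean. Restricting to the support of the random colouring
  ensures that only labels of \<open>T\<close> are used.
\<close>
lemma exists_colouring_many_arc_edges:
  assumes G: "ordered_graph G" and T: "fwd_template T"
  shows "\<exists>c. c ` verts G \<subseteq> labels T \<and>
             template_weight T * real (card (edges G)) \<le> real (card (edges (arc_subgraph c T G)))"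
proof (rule ccontr)
  assume neg: "\<not> ?thesis"
  let ?M = "Pi_pmf (verts G) undefined (\<lambda>_. weight T)"
  let ?K = "\<lambda>e. {c. (c (Min e), c (Max e)) \<in> arcs T}"
  let ?X = "\<lambda>c. real (card (edges (arc_subgraph c T G)))"
  have fin: "finite (verts G)" "finite (edges G)"
    using G finite_edges unfolding ordered_graph_def by auto
  have A: "finite (arcs T)"
    using T unfolding fwd_template_def by (meson finite_SigmaI finite_subset)
  have X: "?X = (\<lambda>c. \<Sum>e\<in>edges G. indicat_real (?K e) c)"
  proof
    fix c
    have "?X c = (\<Sum>e\<in>edges G. if (c (Min e), c (Max e)) \<in> arcs T then 1 else 0)"
      using fin by (simp add: arc_subgraph_def sum.If_cases Int_def)
    thus "?X c = (\<Sum>e\<in>edges G. indicat_real (?K e) c)"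
      by (simp add: indicator_def of_bool_def)
  qed
  have kept: "measure_pmf.prob ?M (?K e) = template_weight T" if "e \<in> edges G" for e
  proof -
    have e: "card e = 2" "e \<subseteq> verts G"
      using G that unfolding ordered_graph_def by auto
    hence "finite e" "e \<noteq> {}" and "Min e \<noteq> Max e"
      by (auto simp: card_2_iff min_def max_def split: if_splits)
    thus ?thesis
      using e fin(1) A by (intro prob_coloured_pair_in_arcs) (auto dest: Min_in Max_in)
  qed
  have int: "integrable ?M ?X"
    unfolding X
    by (intro Bochner_Integration.integrable_sum integrable_real_indicator)
       (auto simp: measure_pmf.emeasure_eq_measure)
  have "measure_pmf.expectation ?M ?X = (\<Sum>e\<in>edges G. measure_pmf.prob ?M (?K e))"
    unfolding X
    by (subst Bochner_Integration.integral_sum)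
       (auto intro!: integrable_real_indicator simp: measure_pmf.emeasure_eq_measure)
  also have "\<dots> = template_weight T * real (card (edges G))"
    by (simp add: kept)
  finally have mean: "measure_pmf.expectation ?M ?X = template_weight T * real (card (edges G))" .
  have "?X c < template_weight T * real (card (edges G))" if "c \<in> set_pmf ?M" for c
  proof -
    have "c ` verts G \<subseteq> labels T"
      using that T fin(1) unfolding fwd_template_def by (auto simp: set_Pi_pmf PiE_dflt_def)
    thus ?thesis using neg by (auto simp: not_le)
  qed
  hence "measure_pmf.expectation ?M ?X < template_weight T * real (card (edges G))"
    by (intro measure_pmf.expectation_less int) (simp add: AE_measure_pmf_iff)
  with mean show False by simp
qed

lemma card_edges_le_ex_ord:
  assumes G: "ordered_graph G" and H: "subgraph_of H G" "\<not> contains_copy H F"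
  shows "card (edges H) \<le> ex_ord G F"
proof -
  let ?S = "{card (edges H) | H. subgraph_of H G \<and> \<not> contains_copy H F}"
  have "?S \<subseteq> {..card (edges G)}"
    using finite_edges[OF G] by (auto simp: subgraph_of_def intro: card_mono)
  hence "finite ?S" by (rule finite_subset) simp
  moreover have "card (edges H) \<in> ?S" using H by blast
  ultimately show ?thesis
    unfolding ex_ord_def Let_def by (auto intro: Max_ge)
qed

lemma template_weight_le_ex_ord_ratio:
  assumes F: "ordered_graph F" and T: "fwd_template T" "\<not> supports T F"
    and G: "ordered_graph G" "edges G \<noteq> {}"
  shows "template_weight T \<le> real (ex_ord G F) / real (card (edges G))"
proof -
  obtain c where c: "c ` verts G \<subseteq> labels T"
    and le: "template_weight T * real (card (edges G)) \<le> real (card (edges (arc_subgraph c T G)))"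
    using exists_colouring_many_arc_edges[OF G(1) T(1)] by blast
  note le
  also have "real (card (edges (arc_subgraph c T G))) \<le> real (ex_ord G F)"
    using card_edges_le_ex_ord[OF G(1) subgraph_of_arc_subgraph[OF G(1)]
        not_contains_copy_arc_subgraph[OF F T(2) c]] by simp
  finally show ?thesis
    using G finite_edges[OF G(1)] by (simp add: pos_le_divide_eq card_gt_0_iff)
qed

text \<open>
  The infimum in \<open>rel_turan_density\<close> is a genuine greatest lower bound only because some ordered
  graph has an edge.
\<close>
lemma le_rel_turan_density:
  assumes "\<And>G :: nat ograph. ordered_graph G \<Longrightarrow> edges G \<noteq> {}
             \<Longrightarrow> b \<le> real (ex_ord G F) / real (card (edges G))"
  shows "b \<le> rel_turan_density F"
proof -
  let ?K = "\<lparr>verts = {0, 1}, edges = {{0, 1}}\<rparr> :: nat ograph"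
  have "ordered_graph ?K" "edges ?K \<noteq> {}"
    by (auto simp: ordered_graph_def)
  thus ?thesis
    unfolding rel_turan_density_def by (intro cInf_greatest) (use assms in blast)+
qed

theorem theorem3p2:
  fixes F :: "'v::linorder ograph"
  assumes "ordered_graph F"
  shows "rel_turan_density F \<ge> template_density F"
proof -
  let ?S = "{template_weight T | T :: nat template. fwd_template T \<and> \<not> supports T F}"
  show ?thesis
  proof (cases "?S = {}")
    case True
    (* This happens when F has no edges: every map to the labels then supports F. *)
    hence "template_density F = 0"
      unfolding template_density_def Let_def by simp
    thus ?thesis by (auto intro: le_rel_turan_density)
  next
    case False
    hence "template_density F = Sup ?S"
      unfolding template_density_def Let_def by (rule if_not_P)
    also have "\<dots> \<le> rel_turan_density F"
      using False assms
      by (intro cSup_least) (auto intro!: le_rel_turan_density template_weight_le_ex_ord_ratio)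
    finally show ?thesis .
  qed
qed

end
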